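(* Let $S_G$ (distributed generators) and $S_D$ (consumers) be finite nonempty index sets. For $i\in S_G$ let $\alpha_i>0$, $\beta_i,\gamma_i\in\mathbb{R}$, $P^{Gen}_{i,max}>0$, and $C_i(p)=\alpha_i p^2+\beta_i p+\gamma_i$. For $j\in S_D$ let $\omega_j>0$, $b_j>0$, $P^{Load}_{j,max}=\omega_j/(2b_j)$, and let $U_j(p)=\omega_j p-b_jp^2$ for $p\le \omega_j/(2b_j)$ and $U_j(p)=\omega_j^2/(4b_j)$ for $p\ge\omega_j/(2b_j)$. Let each consumer $j\in S_D$ be connected to exactly one generator $g(j)\in S_G$. Let $\left((\lambda_i)_{i\in S_G},(P_i^{Gen})_{i\in S_G},(P_j^{Load})_{j\in S_D}\right)$ be a fixed point (as defined in the context) of the distributed economic dispatch algorithm. Then $\left((P_i^{Gen})_{i\in S_G},(P_j^{Load})_{j\in S_D}\right)$ is a global optimal solution of the economic dispatch problem $$\min\ \sum_{i\in S_G}C_i(P_i^{Gen})-\sum_{j\in S_D}U_j(P_j^{Load})$$ subject to $\sum_{i\in S_G}P_i^{Gen}=\sum_{j\in S_D}P_j^{Load}$, $0\le P_i^{Gen}\le P^{Gen}_{i,max}$ for all $i\in S_G$, and $0\le P_j^{Load}\le P^{Load}_{j,max}$ for all $j\in S_D$.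
   Context: A fixed point of the distributed algorithm consists of real numbers $\lambda_i$ ($i\in S_G$, the incremental cost held by generator $i$), $P_i^{Gen}$ ($i\in S_G$) and $P_j^{Load}$ ($j\in S_D$) such that: (1) all incremental costs agree: there is $\lambda\in\mathbb{R}$ with $\lambda_i=\lambda$ for all $i\in S_G$; (2) each generator's output is the saturated value: $P_i^{Gen}=0$ if $\frac{\lambda_i-\beta_i}{2\alpha_i}\le 0$; $P_i^{Gen}=\frac{\lambda_i-\beta_i}{2\alpha_i}$ if $0<\frac{\lambda_i-\beta_i}{2\alpha_i}<P^{Gen}_{i,max}$; and $P_i^{Gen}=P^{Gen}_{i,max}$ if $\frac{\lambda_i-\beta_i}{2\alpha_i}\ge P^{Gen}_{i,max}$; (3) each consumer's demand is the saturated value, using the price of its generator $i=g(j)$: $P_j^{Load}=0$ if $\frac{\omega_j-\lambda_i}{2b_j}\le 0$; $P_j^{Load}=\frac{\omega_j-\lambda_i}{2b_j}$ if $0<\frac{\omega_j-\lambda_i}{2b_j}<P^{Load}_{j,max}$; and $P_j^{Load}=P^{Load}_{j,max}$ if $\frac{\omega_j-\lambda_i}{2b_j}\ge P^{Load}_{j,max}$; (4) the total power mismatch vanishes: $\sum_{i\in S_G}\Delta P_i=0$, where $\Delta P_i=P_i^{Gen}-P_i^{L}$ and $P_i^L=\sum_{j\in S_D:\,g(j)=i}P_j^{Load}$ is the total local load connected to generator $i$. *)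

theory Defs
  imports Complex_Main
begin

definition gen_cost :: "real \<Rightarrow> real \<Rightarrow> real \<Rightarrow> real \<Rightarrow> real" where
  "gen_cost a b c p = a * p\<^sup>2 + b * p + c"

definition utility :: "real \<Rightarrow> real \<Rightarrow> real \<Rightarrow> real" where
  "utility w b p = (if p \<le> w / (2 * b) then w * p - b * p\<^sup>2 else w\<^sup>2 / (4 * b))"

definition saturate :: "real \<Rightarrow> real \<Rightarrow> real" where
  "saturate m x = (if x \<le> 0 then 0 else if x < m then x else m)"

definition local_load :: "'d set \<Rightarrow> ('d \<Rightarrow> 'g) \<Rightarrow> ('d \<Rightarrow> real) \<Rightarrow> 'g \<Rightarrow> real" where
  "local_load SD g PL i = (\<Sum>j | j \<in> SD \<and> g j = i. PL j)"

definition power_mismatch ::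
  "'d set \<Rightarrow> ('d \<Rightarrow> 'g) \<Rightarrow> ('g \<Rightarrow> real) \<Rightarrow> ('d \<Rightarrow> real) \<Rightarrow> 'g \<Rightarrow> real" where
  "power_mismatch SD g PG PL i = PG i - local_load SD g PL i"

definition dispatch_fixed_point ::
  "'g set \<Rightarrow> 'd set \<Rightarrow> ('d \<Rightarrow> 'g) \<Rightarrow> ('g \<Rightarrow> real) \<Rightarrow> ('g \<Rightarrow> real) \<Rightarrow> ('g \<Rightarrow> real) \<Rightarrow>
    ('d \<Rightarrow> real) \<Rightarrow> ('d \<Rightarrow> real) \<Rightarrow> ('d \<Rightarrow> real) \<Rightarrow>
    ('g \<Rightarrow> real) \<Rightarrow> ('g \<Rightarrow> real) \<Rightarrow> ('d \<Rightarrow> real) \<Rightarrow> bool" where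
  "dispatch_fixed_point SG SD g \<alpha> \<beta> PGmax \<omega> b PLmax lam PG PL \<longleftrightarrow>
     (\<exists>l. \<forall>i\<in>SG. lam i = l) \<and>
     (\<forall>i\<in>SG. PG i = saturate (PGmax i) ((lam i - \<beta> i) / (2 * \<alpha> i))) \<and>
     (\<forall>j\<in>SD. PL j = saturate (PLmax j) ((\<omega> j - lam (g j)) / (2 * b j))) \<and>
     (\<Sum>i\<in>SG. power_mismatch SD g PG PL i) = 0"

definition dispatch_feasible ::
  "'g set \<Rightarrow> 'd set \<Rightarrow> ('g \<Rightarrow> real) \<Rightarrow> ('d \<Rightarrow> real) \<Rightarrow>
    ('g \<Rightarrow> real) \<times> ('d \<Rightarrow> real) \<Rightarrow> bool" where
  "dispatch_feasible SG SD PGmax PLmax = (\<lambda>(PG, PL).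
     (\<Sum>i\<in>SG. PG i) = (\<Sum>j\<in>SD. PL j) \<and>
     (\<forall>i\<in>SG. 0 \<le> PG i \<and> PG i \<le> PGmax i) \<and>
     (\<forall>j\<in>SD. 0 \<le> PL j \<and> PL j \<le> PLmax j))"

definition dispatch_objective ::
  "'g set \<Rightarrow> 'd set \<Rightarrow> ('g \<Rightarrow> real) \<Rightarrow> ('g \<Rightarrow> real) \<Rightarrow> ('g \<Rightarrow> real) \<Rightarrow>
    ('d \<Rightarrow> real) \<Rightarrow> ('d \<Rightarrow> real) \<Rightarrow> ('g \<Rightarrow> real) \<times> ('d \<Rightarrow> real) \<Rightarrow> real" where
  "dispatch_objective SG SD \<alpha> \<beta> \<gamma> \<omega> b = (\<lambda>(PG, PL).
     (\<Sum>i\<in>SG. gen_cost (\<alpha> i) (\<beta> i) (\<gamma> i) (PG i)) - (\<Sum>j\<in>SD. utility (\<omega> j) (b j) (PL j)))"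

end

theory Submission
  imports Defs
begin

text \<open>Lagrangian relaxation: the common incremental cost \<open>l\<close> prices the power balance. Each
  saturated value is the projection of an unconstrained quadratic minimiser onto the feasible
  interval, hence minimises that agent's own term of the Lagrangian (\<open>C\<^sub>i(p) - l p\<close> or
  \<open>l p - U\<^sub>j(p)\<close>). Summing over all agents, the terms in \<open>l\<close> cancel at balanced points.\<close>

lemma saturate_bounds:
  assumes "0 \<le> m"
  shows "0 \<le> saturate m x" and "saturate m x \<le> m"
  using assms by (auto simp: saturate_def)

text \<open>If \<open>x\<close> lies strictly between \<open>0\<close> and \<open>m\<close>, the
  left side is zero; otherwise \<open>saturate\<close> picks the endpoint facing \<open>x\<close>,
  and every \<open>q\<close> in the interval lies at or beyond it.\<close>

lemma saturate_nearest:
  assumes "0 \<le> q" and "q \<le> m"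
  shows "\<bar>saturate m x - x\<bar> \<le> \<bar>q - x\<bar>"
  using assms by (auto simp: saturate_def)

text \<open>Completing the square with \<open>x = c / (2 * a)\<close> turns
  \<open>a * p\<^sup>2 - c * p\<close> into \<open>a * (p - x)\<^sup>2\<close> minus a constant. As
  \<open>a > 0\<close>, the point of the interval nearest to \<open>x\<close> gives the least
  value.\<close>

lemma saturate_minimises_quadratic:
  fixes a c m q :: real
  assumes "a > 0" and "0 \<le> q" and "q \<le> m"
  defines "p \<equiv> saturate m (c / (2 * a))"
  shows "a * p\<^sup>2 - c * p \<le> a * q\<^sup>2 - c * q"
proof -
  define x where "x = c / (2 * a)"
  have c: "c = 2 * a * x"
    using \<open>a > 0\<close> by (simp add: x_def)
  have "(p - x)\<^sup>2 \<le> (q - x)\<^sup>2"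
    using saturate_nearest[OF assms(2,3)] by (simp add: p_def x_def abs_le_square_iff)
  then have "a * (p - x)\<^sup>2 \<le> a * (q - x)\<^sup>2"
    using \<open>a > 0\<close> by simp
  then show ?thesis
    by (simp add: c power2_eq_square algebra_simps)
qed

text \<open>The fibres of \<open>g\<close> over \<open>SG\<close> partition \<open>SD\<close>, so
  each consumer is counted exactly once. This turns zero total mismatch into the balance
  constraint.\<close>

lemma sum_local_load:
  assumes "finite SG" and "finite SD" and "\<And>j. j \<in> SD \<Longrightarrow> g j \<in> SG"
  shows "(\<Sum>i\<in>SG. local_load SD g PL i) = (\<Sum>j\<in>SD. PL j)"
  unfolding local_load_def using assms by (intro sum.group) auto

theorem mainTheorem1:
  fixes SG :: "'g set" and SD :: "'d set" and g :: "'d \<Rightarrow> 'g"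
    and \<alpha> \<beta> \<gamma> PGmax lam PG :: "'g \<Rightarrow> real"
    and \<omega> b PLmax PL :: "'d \<Rightarrow> real"
  assumes "finite SG" and "SG \<noteq> {}" and "finite SD" and "SD \<noteq> {}"
    and "\<And>i. i \<in> SG \<Longrightarrow> \<alpha> i > 0"
    and "\<And>i. i \<in> SG \<Longrightarrow> PGmax i > 0"
    and "\<And>j. j \<in> SD \<Longrightarrow> \<omega> j > 0"
    and "\<And>j. j \<in> SD \<Longrightarrow> b j > 0"
    and "\<And>j. j \<in> SD \<Longrightarrow> PLmax j = \<omega> j / (2 * b j)"
    and "\<And>j. j \<in> SD \<Longrightarrow> g j \<in> SG"
    and "dispatch_fixed_point SG SD g \<alpha> \<beta> PGmax \<omega> b PLmax lam PG PL"
  shows "is_arg_min (dispatch_objective SG SD \<alpha> \<beta> \<gamma> \<omega> b)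
           (dispatch_feasible SG SD PGmax PLmax) (PG, PL)"
proof -
  from assms(11) obtain l where l: "\<And>i. i \<in> SG \<Longrightarrow> lam i = l"
    and "\<And>i. i \<in> SG \<Longrightarrow> PG i = saturate (PGmax i) ((lam i - \<beta> i) / (2 * \<alpha> i))"
    and "\<And>j. j \<in> SD \<Longrightarrow> PL j = saturate (PLmax j) ((\<omega> j - lam (g j)) / (2 * b j))"
    and mismatch: "(\<Sum>i\<in>SG. power_mismatch SD g PG PL i) = 0"
    unfolding dispatch_fixed_point_def by blast
  \<comment> \<open>Each \<open>g j\<close> lies in \<open>SG\<close>, so consumers also face the
    common price \<open>l\<close>.\<close>
  then have PG: "\<And>i. i \<in> SG \<Longrightarrow> PG i = saturate (PGmax i) ((l - \<beta> i) / (2 * \<alpha> i))"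
    and PL: "\<And>j. j \<in> SD \<Longrightarrow> PL j = saturate (PLmax j) ((\<omega> j - l) / (2 * b j))"
    using assms(10) by simp_all
  have "PLmax j > 0" if "j \<in> SD" for j
    using assms(7-9) that by simp
  then have bounds: "\<And>i. i \<in> SG \<Longrightarrow> 0 \<le> PG i \<and> PG i \<le> PGmax i"
      "\<And>j. j \<in> SD \<Longrightarrow> 0 \<le> PL j \<and> PL j \<le> PLmax j"
    using assms(6) by (simp_all add: PG PL saturate_bounds less_imp_le)
  have balance: "sum PG SG = sum PL SD"
    using mismatch sum_local_load[where g = g and PL = PL, OF assms(1,3,10)]
    by (simp add: power_mismatch_def sum_subtractf)
  have feasible: "dispatch_feasible SG SD PGmax PLmax (PG, PL)"
    using bounds balance by (simp add: dispatch_feasible_def)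
  have optimal: "dispatch_objective SG SD \<alpha> \<beta> \<gamma> \<omega> b (PG, PL)
      \<le> dispatch_objective SG SD \<alpha> \<beta> \<gamma> \<omega> b (QG, QL)"
    if Q: "dispatch_feasible SG SD PGmax PLmax (QG, QL)" for QG QL
  proof -
    have Q_balance: "sum QG SG = sum QL SD"
      and QG: "\<And>i. i \<in> SG \<Longrightarrow> 0 \<le> QG i \<and> QG i \<le> PGmax i"
      and QL: "\<And>j. j \<in> SD \<Longrightarrow> 0 \<le> QL j \<and> QL j \<le> PLmax j"
      using Q by (auto simp: dispatch_feasible_def)
    \<comment> \<open>Here the quadratic lemma has linear coefficient \<open>l - \<beta> i\<close>;
      the constant \<open>\<gamma> i\<close> cancels.\<close>
    have "gen_cost (\<alpha> i) (\<beta> i) (\<gamma> i) (PG i) - l * PG i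
        \<le> gen_cost (\<alpha> i) (\<beta> i) (\<gamma> i) (QG i) - l * QG i" if "i \<in> SG" for i
      using saturate_minimises_quadratic[of "\<alpha> i" "QG i" "PGmax i" "l - \<beta> i"]
        assms(5)[OF that] QG[OF that] PG[OF that]
      by (simp add: gen_cost_def algebra_simps)
    then have gen: "(\<Sum>i\<in>SG. gen_cost (\<alpha> i) (\<beta> i) (\<gamma> i) (PG i) - l * PG i)
        \<le> (\<Sum>i\<in>SG. gen_cost (\<alpha> i) (\<beta> i) (\<gamma> i) (QG i) - l * QG i)"
      by (rule sum_mono)
    \<comment> \<open>The cap \<open>PLmax j\<close> is exactly the kink of the utility, so
      \<open>PL j\<close> and \<open>QL j\<close> both fall on its quadratic branch, and the term to
      minimise is \<open>b j * p\<^sup>2 - (\<omega> j - l) * p\<close>.\<close>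
    have "l * PL j - utility (\<omega> j) (b j) (PL j) \<le> l * QL j - utility (\<omega> j) (b j) (QL j)"
      if "j \<in> SD" for j
      using saturate_minimises_quadratic[of "b j" "QL j" "PLmax j" "\<omega> j - l"]
        assms(8)[OF that] assms(9)[OF that] QL[OF that] PL[OF that] bounds(2)[OF that]
      by (simp add: utility_def algebra_simps)
    then have load: "(\<Sum>j\<in>SD. l * PL j - utility (\<omega> j) (b j) (PL j))
        \<le> (\<Sum>j\<in>SD. l * QL j - utility (\<omega> j) (b j) (QL j))"
      by (rule sum_mono)
    show ?thesis
      using gen load
      by (simp add: dispatch_objective_def sum_subtractf balance Q_balance flip: sum_distrib_left)
  qed
  show ?thesis
    \<comment> \<open>\<open>is_arg_min\<close> says that no feasible point is strictly better; in a
      linear order this is the inequality just proved.\<close>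
    using feasible optimal by (force simp: is_arg_min_linorder)
qed

end
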